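(* Let $n\ge 1$, let $\Lambda(\xi)\in\mathbb{C}[\xi]$ and $P(z), g(z)\in\mathbb{C}[z]$, and set $f(\xi,z):=\Lambda(\xi)P(z)\in\mathbb{C}[\xi,z]$. Then the following two statements are equivalent: (a) (the vanishing conjecture holds for $\Lambda(\partial)$, $P$ and $g$) if $\Lambda(\partial)^m(P^m)=0$ for each $m\ge 1$, then $\Lambda(\partial)^m(P^m g)=0$ for all sufficiently large $m$; (b) (the image conjecture holds for $f$ and $g$) if $f^m\in\operatorname{Im}\Theta$ for each $m\ge 1$, then $f^m g\in\operatorname{Im}\Theta$ for all sufficiently large $m$.
   Context: Here $z=(z_1,\dots,z_n)$ and $\xi=(\xi_1,\dots,\xi_n)$ are commuting free variables, $\mathbb{C}[z]$, $\mathbb{C}[\xi]$, $\mathbb{C}[\xi,z]$ are the polynomial algebras, and $\partial_i:=\partial/\partial z_i$, $\partial:=(\partial_1,\dots,\partial_n)$. For $\Lambda(\xi)\in\mathbb{C}[\xi]$, $\Lambda(\partial)$ denotes the constant-coefficient differential operator on $\mathbb{C}[z]$ obtained by replacing each $\xi_i$ by $\partial_i$. Put $\Theta_i:=\xi_i-\partial_i$ ($1\le i\le n$), a differential operator of $\mathbb{C}[\xi,z]$ ($h\mapsto \xi_i h-\partial h/\partial z_i$), $\Theta:=\{\Theta_1,\dots,\Theta_n\}$, and $\operatorname{Im}\Theta:=\sum_{i=1}^n\Theta_i(\mathbb{C}[\xi,z])$. *)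

theory Defs
  imports Complex_Main "HOL-Library.Poly_Mapping"
begin

text \<open>
  Polynomials over the complex numbers in commuting variables of type \<open>'v\<close>: finitely supported
  maps from monomials (exponent vectors) to coefficients, with the convolution product of
  \<open>Poly_Mapping\<close>.  The ring in \<open>n\<close> variables is the case where \<open>'v\<close> is a finite type with \<open>n\<close>
  elements.
\<close>

type_synonym 'v cpoly = "('v \<Rightarrow>\<^sub>0 nat) \<Rightarrow>\<^sub>0 complex"

definition const :: "complex \<Rightarrow> 'v cpoly" where
  "const c = Poly_Mapping.single 0 c"

definition Var :: "'v \<Rightarrow> 'v cpoly" where
  "Var i = Poly_Mapping.single (Poly_Mapping.single i 1) 1"

definition subst_poly :: "('v \<Rightarrow> 'w cpoly) \<Rightarrow> 'v cpoly \<Rightarrow> 'w cpoly" where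
  "subst_poly \<sigma> p = (\<Sum>\<alpha>\<in>Poly_Mapping.keys p. const (Poly_Mapping.lookup p \<alpha>) * (\<Prod>i\<in>Poly_Mapping.keys \<alpha>. \<sigma> i ^ Poly_Mapping.lookup \<alpha> i))"

text \<open>
  In the next definition the exponent subtraction truncates only when \<open>i\<close> does not occur in the
  monomial \<open>\<alpha>\<close>; then the coefficient is zero.
\<close>

definition partial :: "'v \<Rightarrow> 'v cpoly \<Rightarrow> 'v cpoly" where
  "partial i p = (\<Sum>\<alpha>\<in>Poly_Mapping.keys p. Poly_Mapping.single (\<alpha> - Poly_Mapping.single i 1)
      (of_nat (Poly_Mapping.lookup \<alpha> i) * Poly_Mapping.lookup p \<alpha>))"

lemma lookup_partial:
  "Poly_Mapping.lookup (partial i p) \<beta> =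
     of_nat (Poly_Mapping.lookup \<beta> i + 1) * Poly_Mapping.lookup p (\<beta> + Poly_Mapping.single i 1)"
proof -
  let ?e = "Poly_Mapping.single i (1::nat)"
  have eq: "(of_nat (Poly_Mapping.lookup \<alpha> i) * Poly_Mapping.lookup p \<alpha> when \<alpha> - ?e = \<beta>) =
      (if \<alpha> = \<beta> + ?e then of_nat (Poly_Mapping.lookup \<beta> i + 1) * Poly_Mapping.lookup p (\<beta> + ?e) else 0)" for \<alpha>
  proof (cases "Poly_Mapping.lookup \<alpha> i = 0")
    case True
    then have "\<alpha> \<noteq> \<beta> + ?e" by (auto simp: lookup_add)
    with True show ?thesis by simp
  next
    case False
    then have "\<alpha> = (\<alpha> - ?e) + ?e"
      by (intro poly_mapping_eqI) (auto simp: lookup_add lookup_minus lookup_single when_def)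
    then have "\<alpha> - ?e = \<beta> \<longleftrightarrow> \<alpha> = \<beta> + ?e" by (metis add_diff_cancel_right')
    then show ?thesis by (auto simp: lookup_add when_def)
  qed
  have "Poly_Mapping.lookup (partial i p) \<beta> =
      (\<Sum>\<alpha>\<in>Poly_Mapping.keys p. if \<alpha> = \<beta> + ?e then of_nat (Poly_Mapping.lookup \<beta> i + 1) * Poly_Mapping.lookup p (\<beta> + ?e) else 0)"
    unfolding partial_def lookup_sum lookup_single eq ..
  also have "\<dots> = of_nat (Poly_Mapping.lookup \<beta> i + 1) * Poly_Mapping.lookup p (\<beta> + ?e)"
    by (auto simp: sum.delta' in_keys_iff)
  finally show ?thesis .
qed

lemma partial_commute: "partial i (partial j p) = partial j (partial i p)"
  by (rule poly_mapping_eqI) (auto simp: lookup_partial lookup_add lookup_single when_def ac_simps)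

text \<open>
  The iterated derivative with multi-index \<open>\<alpha>\<close>; the order of composition is immaterial by
  \<open>comp_fun_commute_partial\<close> below.
\<close>

definition partials :: "('v \<Rightarrow>\<^sub>0 nat) \<Rightarrow> 'v cpoly \<Rightarrow> 'v cpoly" where
  "partials \<alpha> p = Finite_Set.fold (\<lambda>i. partial i ^^ Poly_Mapping.lookup \<alpha> i) p (Poly_Mapping.keys \<alpha>)"

lemma comp_fun_commute_partial: "comp_fun_commute (\<lambda>i. partial i ^^ k i)"
proof
  fix i j :: 'a
  have *: "partial i ((partial j ^^ b) p) = (partial j ^^ b) (partial i p)" for b and p :: "'a cpoly"
    by (induction b) (simp_all add: partial_commute[of i j])
  have "(partial i ^^ a) ((partial j ^^ b) p) = (partial j ^^ b) ((partial i ^^ a) p)"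
    for a b and p :: "'a cpoly"
    by (induction a) (simp_all add: *)
  then show "partial j ^^ k j \<circ> partial i ^^ k i = partial i ^^ k i \<circ> partial j ^^ k j"
    by (simp add: fun_eq_iff)
qed

definition diff_op :: "'v cpoly \<Rightarrow> 'v cpoly \<Rightarrow> 'v cpoly" where
  "diff_op \<Lambda> p = (\<Sum>\<alpha>\<in>Poly_Mapping.keys \<Lambda>. const (Poly_Mapping.lookup \<Lambda> \<alpha>) * partials \<alpha> p)"

text \<open>The two families of variables \<open>\<xi>\<close> and \<open>z\<close> of the ring of polynomials in both.\<close>

datatype 'n xi_z = Xi 'n | Z 'n

definition in_xi :: "'n cpoly \<Rightarrow> 'n xi_z cpoly" where
  "in_xi = subst_poly (\<lambda>i. Var (Xi i))"

definition in_z :: "'n cpoly \<Rightarrow> 'n xi_z cpoly" where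
  "in_z = subst_poly (\<lambda>i. Var (Z i))"

definition Theta :: "'n \<Rightarrow> 'n xi_z cpoly \<Rightarrow> 'n xi_z cpoly" where
  "Theta i h = Var (Xi i) * h - partial (Z i) h"

definition Im_Theta :: "'n::finite xi_z cpoly set" where
  "Im_Theta = {\<Sum>i\<in>UNIV. Theta i (h i) | h. True}"

end

theory Submission
  imports Defs
begin

text \<open>
  Modulo \<open>Im_Theta\<close> multiplication by \<open>\<xi>\<^sub>i\<close> is the same as \<open>\<partial>/\<partial>z\<^sub>i\<close>, and \<open>Im_Theta\<close> is stable under
  multiplication by polynomials in \<open>\<xi>\<close>, because these commute with every \<open>\<Theta>\<^sub>i\<close>.  Hence
  \<open>A(\<xi>)\<^sup>m q(z)\<close> is congruent to \<open>A(\<partial>)\<^sup>m q(z)\<close> modulo \<open>Im_Theta\<close>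
  (\<open>in_xi_power_mult_in_z_cong\<close>).  On the other hand no non-zero polynomial in \<open>z\<close> alone lies in
  \<open>Im_Theta\<close> (\<open>in_z_in_Im_Theta_iff\<close>): the linear functional that sends \<open>\<xi>\<^sup>\<alpha> z\<^sup>\<beta>\<close> to \<open>\<beta>!\<close> if
  \<open>\<beta> = \<alpha> + \<delta>\<close> and to \<open>0\<close> otherwise, which is \<open>\<delta>!\<close> times the coefficient of \<open>z\<^sup>\<delta>\<close> in \<open>\<partial>\<^sup>\<alpha> z\<^sup>\<beta>\<close>,
  kills \<open>Im_Theta\<close>, and it sends a polynomial in \<open>z\<close> to \<open>\<delta>!\<close> times its coefficient at \<open>z\<^sup>\<delta>\<close>.

  Together, \<open>A(\<xi>)\<^sup>m q(z)\<close> lies in \<open>Im_Theta\<close> if and only if \<open>A(\<partial>)\<^sup>m q = 0\<close>.  Taking \<open>q = P\<^sup>m\<close> and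
  \<open>q = P\<^sup>m g\<close>, the hypotheses of the two conjectures are equivalent, and so are their conclusions.
\<close>

section \<open>Linear extension from monomials, and substitution\<close>

text \<open>The linear functional with prescribed values on the monomials.\<close>

definition lin_ext :: "(('v \<Rightarrow>\<^sub>0 nat) \<Rightarrow> complex) \<Rightarrow> 'v cpoly \<Rightarrow> complex" where
  "lin_ext w p = (\<Sum>\<alpha>\<in>Poly_Mapping.keys p. Poly_Mapping.lookup p \<alpha> * w \<alpha>)"

lemma lin_ext_add: "lin_ext w (p + q) = lin_ext w p + lin_ext w q"
  unfolding lin_ext_def
  by (rule setsum_keys_plus_distrib[where f = "\<lambda>\<alpha> c. c * w \<alpha>"]) (simp_all add: distrib_right)

lemma lin_ext_single: "lin_ext w (Poly_Mapping.single \<alpha> c) = c * w \<alpha>"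
  by (simp add: lin_ext_def)

lemma lin_ext_zero: "lin_ext w 0 = 0"
  by (simp add: lin_ext_def)

lemma lin_ext_diff: "lin_ext w (p - q) = lin_ext w p - lin_ext w q"
  using lin_ext_add[of w "p - q" q] by simp

lemma lin_ext_sum: "lin_ext w (\<Sum>i\<in>I. p i) = (\<Sum>i\<in>I. lin_ext w (p i))"
  by (induction I rule: infinite_finite_induct) (simp_all add: lin_ext_add lin_ext_zero)

lemma cpoly_induct [case_names single add]:
  fixes p :: "'v cpoly"
  assumes "\<And>\<alpha> c. Q (Poly_Mapping.single \<alpha> c)"
    and "\<And>p q. Q p \<Longrightarrow> Q q \<Longrightarrow> Q (p + q)"
  shows "Q p"
proof (induction p rule: update_induct)
  case const
  show ?case using assms(1)[of 0 0] by simp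
next
  case (update p \<alpha> c)
  have "Poly_Mapping.update \<alpha> c p = p + Poly_Mapping.single \<alpha> c"
    using update.hyps(1)
    by (intro poly_mapping_eqI) (auto simp: lookup_update lookup_add lookup_single in_keys_iff)
  then show ?case using assms(2)[OF update.IH assms(1)] by simp
qed

lemma subst_poly_single:
  "subst_poly \<sigma> (Poly_Mapping.single \<alpha> c) =
     const c * (\<Prod>i\<in>Poly_Mapping.keys \<alpha>. \<sigma> i ^ Poly_Mapping.lookup \<alpha> i)"
  by (simp add: subst_poly_def const_def)

lemma const_add: "const (c + d) = const c + const d"
  by (simp add: const_def single_add)

lemma const_mult: "const (c * d) = const c * const d"
  by (simp add: const_def mult_single)

lemma const_0: "const 0 = 0"
  by (simp add: const_def)

lemma const_1: "const 1 = 1"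
  by (simp add: const_def)

lemma subst_poly_add: "subst_poly \<sigma> (p + q) = subst_poly \<sigma> p + subst_poly \<sigma> q"
  unfolding subst_poly_def
  by (rule setsum_keys_plus_distrib
        [where f = "\<lambda>\<alpha> c. const c * (\<Prod>i\<in>Poly_Mapping.keys \<alpha>. \<sigma> i ^ Poly_Mapping.lookup \<alpha> i)"])
     (simp_all add: const_add const_0 distrib_right)

lemma subst_poly_0: "subst_poly \<sigma> 0 = 0"
  by (simp add: subst_poly_def)

lemma subst_poly_sum: "subst_poly \<sigma> (\<Sum>i\<in>I. p i) = (\<Sum>i\<in>I. subst_poly \<sigma> (p i))"
  by (induction I rule: infinite_finite_induct) (simp_all add: subst_poly_add subst_poly_0)

lemma subst_poly_const: "subst_poly \<sigma> (const c) = const c"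
  unfolding const_def[of c] by (subst subst_poly_single) (simp add: const_def)

lemma subst_poly_Var: "subst_poly \<sigma> (Var i) = \<sigma> i"
  by (simp add: Var_def subst_poly_single const_1)

lemma prod_keys_add:
  fixes \<sigma> :: "'v \<Rightarrow> 'a::comm_monoid_mult"
  shows "(\<Prod>i\<in>Poly_Mapping.keys (\<alpha> + \<beta>). \<sigma> i ^ Poly_Mapping.lookup (\<alpha> + \<beta>) i) =
     (\<Prod>i\<in>Poly_Mapping.keys \<alpha>. \<sigma> i ^ Poly_Mapping.lookup \<alpha> i) *
     (\<Prod>i\<in>Poly_Mapping.keys \<beta>. \<sigma> i ^ Poly_Mapping.lookup \<beta> i)"
proof -
  let ?S = "Poly_Mapping.keys \<alpha> \<union> Poly_Mapping.keys \<beta>"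
  have *: "(\<Prod>i\<in>Poly_Mapping.keys \<gamma>. \<sigma> i ^ Poly_Mapping.lookup \<gamma> i) =
      (\<Prod>i\<in>?S. \<sigma> i ^ Poly_Mapping.lookup \<gamma> i)" if "Poly_Mapping.keys \<gamma> \<subseteq> ?S" for \<gamma>
    using that by (intro prod.mono_neutral_left) (auto simp: in_keys_iff)
  show ?thesis
    unfolding *[OF Poly_Mapping.keys_add] *[OF Un_upper1] *[OF Un_upper2]
    by (simp only: lookup_add power_add prod.distrib)
qed

lemma subst_poly_mult: "subst_poly \<sigma> (p * q) = subst_poly \<sigma> p * subst_poly \<sigma> q"
proof (induction p rule: cpoly_induct)
  case (single \<alpha> c)
  show ?case
    by (induction q rule: cpoly_induct)
       (simp_all add: mult_single subst_poly_single prod_keys_add const_mult subst_poly_add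
          algebra_simps)
qed (simp add: distrib_right subst_poly_add)

lemma subst_poly_1: "subst_poly \<sigma> 1 = 1"
  using subst_poly_const[of \<sigma> 1] by (simp add: const_1)

lemma subst_poly_power: "subst_poly \<sigma> (p ^ m) = subst_poly \<sigma> p ^ m"
  by (induction m) (simp_all add: subst_poly_1 subst_poly_mult)

section \<open>Partial derivatives\<close>

lemma partial_add: "partial i (p + q) = partial i p + partial i q"
  by (rule poly_mapping_eqI) (simp add: lookup_partial lookup_add algebra_simps)

lemma partial_0: "partial i 0 = 0"
  by (rule poly_mapping_eqI) (simp add: lookup_partial)

lemma partial_sum: "partial i (\<Sum>j\<in>I. p j) = (\<Sum>j\<in>I. partial i (p j))"
  by (induction I rule: infinite_finite_induct) (simp_all add: partial_add partial_0)

lemma partial_single: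
  "partial i (Poly_Mapping.single \<alpha> c) =
     Poly_Mapping.single (\<alpha> - Poly_Mapping.single i 1) (of_nat (Poly_Mapping.lookup \<alpha> i) * c)"
  by (simp add: partial_def)

lemma partial_mult: "partial i (p * q) = partial i p * q + p * partial i q"
proof (induction p rule: cpoly_induct)
  case (single \<alpha> c)
  show ?case
  proof (induction q rule: cpoly_induct)
    case (single \<beta> d)
    let ?e = "Poly_Mapping.single i (1::nat)"
    \<comment> \<open>The exponent subtraction truncates only if the coefficient vanishes.\<close>
    have shift: "Poly_Mapping.single (\<mu> - ?e + \<nu>) (of_nat (Poly_Mapping.lookup \<mu> i) * x) =
        Poly_Mapping.single (\<mu> + \<nu> - ?e) (of_nat (Poly_Mapping.lookup \<mu> i) * x)"
      for \<mu> \<nu> :: "'a \<Rightarrow>\<^sub>0 nat" and x :: complex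
    proof (cases "Poly_Mapping.lookup \<mu> i = 0")
      case False
      then have "\<mu> - ?e + \<nu> = \<mu> + \<nu> - ?e"
        by (intro poly_mapping_eqI) (auto simp: lookup_add lookup_minus lookup_single when_def)
      then show ?thesis by simp
    qed simp
    have "partial i (Poly_Mapping.single \<alpha> c) * Poly_Mapping.single \<beta> d =
        Poly_Mapping.single (\<alpha> + \<beta> - ?e) (of_nat (Poly_Mapping.lookup \<alpha> i) * (c * d))"
      using shift[of \<alpha> \<beta> "c * d"] by (simp add: partial_single mult_single mult.assoc)
    moreover have "Poly_Mapping.single \<alpha> c * partial i (Poly_Mapping.single \<beta> d) =
        Poly_Mapping.single (\<alpha> + \<beta> - ?e) (of_nat (Poly_Mapping.lookup \<beta> i) * (c * d))"
      using shift[of \<beta> \<alpha> "c * d"]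
      by (simp add: partial_single mult_single add.commute mult.left_commute)
    ultimately show ?case
      by (simp add: partial_single mult_single lookup_add distrib_right flip: single_add)
  qed (simp add: distrib_left partial_add algebra_simps)
qed (simp add: distrib_right partial_add algebra_simps)

lemma partial_const: "partial i (const c) = 0"
  by (simp add: const_def partial_single)

lemma partial_Var: "partial i (Var j) = (if i = j then 1 else 0)"
  by (simp add: Var_def partial_single lookup_single)

lemma partial_power_eq_0: "partial i p = 0 \<Longrightarrow> partial i (p ^ k) = 0"
  by (induction k) (simp_all add: partial_mult partial_const flip: const_1)

lemma partial_prod_eq_0: "(\<And>j. j \<in> S \<Longrightarrow> partial i (p j) = 0) \<Longrightarrow> partial i (\<Prod>j\<in>S. p j) = 0"
  by (induction S rule: infinite_finite_induct)
     (simp_all add: partial_mult partial_const flip: const_1)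

lemma partial_Z_in_xi: "partial (Z i) (in_xi A) = 0"
  unfolding in_xi_def subst_poly_def partial_sum
  by (intro sum.neutral ballI)
     (simp add: partial_mult partial_const partial_prod_eq_0 partial_power_eq_0 partial_Var)

lemma monomial_eq_single:
  "(\<Prod>i\<in>S. Var (e i) ^ k i) = Poly_Mapping.single (\<Sum>i\<in>S. Poly_Mapping.single (e i) (k i)) 1"
proof -
  have pow: "Var v ^ m = Poly_Mapping.single (Poly_Mapping.single v m) 1" for v and m :: nat
    by (induction m) (simp_all add: Var_def mult_single flip: single_add)
  show ?thesis
    by (induction S rule: infinite_finite_induct) (simp_all add: pow mult_single)
qed

lemma cpoly_induct_Var [case_names const add Var]:
  fixes p :: "'v cpoly"
  assumes const: "\<And>c. Q (const c)"
    and add: "\<And>p q. Q p \<Longrightarrow> Q q \<Longrightarrow> Q (p + q)"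
    and Var: "\<And>i p. Q p \<Longrightarrow> Q (Var i * p)"
  shows "Q p"
proof (induction p rule: cpoly_induct)
  case (single \<alpha> c)
  have pow: "Q (Var i ^ k * p)" if "Q p" for i k p
    using that by (induction k) (simp_all add: Var mult.assoc)
  have prod: "Q ((\<Prod>i\<in>S. Var i ^ k i) * const c)" if "finite S" for S and k :: "'v \<Rightarrow> nat"
    using that by (induction S) (simp_all add: const pow mult.assoc)
  have "(\<Sum>i\<in>Poly_Mapping.keys \<alpha>. Poly_Mapping.single i (Poly_Mapping.lookup \<alpha> i)) = \<alpha>"
    by (rule poly_mapping_eqI) (simp add: lookup_sum lookup_single when_def in_keys_iff)
  then have "(\<Prod>i\<in>Poly_Mapping.keys \<alpha>. Var i ^ Poly_Mapping.lookup \<alpha> i) * const c =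
      Poly_Mapping.single \<alpha> c"
    using monomial_eq_single[of "\<lambda>i. i" "Poly_Mapping.lookup \<alpha>" "Poly_Mapping.keys \<alpha>"]
    by (simp add: const_def mult_single)
  then show ?case using prod[of "Poly_Mapping.keys \<alpha>"] by (metis finite_keys)
qed (rule add)

lemma partial_Z_in_z: "partial (Z i) (in_z p) = in_z (partial i p)"
  by (induction p rule: cpoly_induct_Var)
     (simp_all add: in_z_def subst_poly_const partial_const subst_poly_0 subst_poly_add
        partial_add subst_poly_mult partial_mult subst_poly_Var partial_Var subst_poly_1)

section \<open>The image of Theta\<close>

lemma Im_Theta_iff: "p \<in> Im_Theta \<longleftrightarrow> (\<exists>h. p = (\<Sum>i\<in>UNIV. Theta i (h i)))"
  by (auto simp: Im_Theta_def)

lemma Theta_add: "Theta i (p + q) = Theta i p + Theta i q"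
  by (simp add: Theta_def partial_add algebra_simps)

lemma Theta_0: "Theta i 0 = 0"
  by (simp add: Theta_def partial_0)

lemma Theta_in_xi_mult: "Theta i (in_xi A * p) = in_xi A * Theta i p"
  by (simp add: Theta_def partial_mult partial_Z_in_xi algebra_simps)

lemma Im_Theta_0: "0 \<in> Im_Theta"
  unfolding Im_Theta_iff by (rule exI[of _ "\<lambda>_. 0"]) (simp add: Theta_0)

lemma Im_Theta_add: "p \<in> Im_Theta \<Longrightarrow> q \<in> Im_Theta \<Longrightarrow> p + q \<in> Im_Theta"
  unfolding Im_Theta_iff
  by (metis (no_types, lifting) Theta_add sum.cong sum.distrib)

lemma Theta_diff: "Theta i (p - q) = Theta i p - Theta i q"
  using Theta_add[of i "p - q" q] by simp

lemma Im_Theta_diff: "p \<in> Im_Theta \<Longrightarrow> q \<in> Im_Theta \<Longrightarrow> p - q \<in> Im_Theta"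
  unfolding Im_Theta_iff by (metis (no_types, lifting) Theta_diff sum.cong sum_subtractf)

lemma Im_Theta_in_xi_mult: "p \<in> Im_Theta \<Longrightarrow> in_xi A * p \<in> Im_Theta"
  unfolding Im_Theta_iff
  by (metis (no_types, lifting) Theta_in_xi_mult sum.cong sum_distrib_left)

lemma Im_Theta_sum: "(\<And>i. i \<in> S \<Longrightarrow> p i \<in> Im_Theta) \<Longrightarrow> (\<Sum>i\<in>S. p i) \<in> Im_Theta"
  by (induction S rule: infinite_finite_induct) (simp_all add: Im_Theta_0 Im_Theta_add)

lemma Theta_in_Im_Theta: "Theta i p \<in> Im_Theta"
proof -
  have "(\<Sum>j\<in>UNIV. Theta j (if j = i then p else 0)) = (\<Sum>j\<in>UNIV. if j = i then Theta i p else 0)"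
    by (intro sum.cong) (auto simp: Theta_0)
  then show ?thesis
    unfolding Im_Theta_iff by (intro exI[of _ "\<lambda>j. if j = i then p else 0"]) simp
qed

text \<open>The congruence modulo \<open>Im_Theta\<close>.\<close>

definition cong_Theta :: "'n::finite xi_z cpoly \<Rightarrow> 'n xi_z cpoly \<Rightarrow> bool" (infix "\<approx>" 50) where
  "p \<approx> q \<longleftrightarrow> p - q \<in> Im_Theta"

lemma cong_Theta_refl: "p \<approx> p"
  by (simp add: cong_Theta_def Im_Theta_0)

lemma cong_Theta_trans [trans]: "p \<approx> q \<Longrightarrow> q \<approx> r \<Longrightarrow> p \<approx> r"
  using Im_Theta_add[of "p - q" "q - r"] by (simp add: cong_Theta_def)

lemma cong_Theta_in_xi_mult: "p \<approx> q \<Longrightarrow> in_xi A * p \<approx> in_xi A * q"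
  using Im_Theta_in_xi_mult[of "p - q" A] by (simp add: cong_Theta_def right_diff_distrib)

lemma cong_Theta_sum: "(\<And>i. i \<in> S \<Longrightarrow> p i \<approx> q i) \<Longrightarrow> (\<Sum>i\<in>S. p i) \<approx> (\<Sum>i\<in>S. q i)"
  using Im_Theta_sum[of S "\<lambda>i. p i - q i"] by (simp add: cong_Theta_def sum_subtractf)

lemma cong_Theta_Im_Theta_iff: "p \<approx> q \<Longrightarrow> p \<in> Im_Theta \<longleftrightarrow> q \<in> Im_Theta"
  unfolding cong_Theta_def using Im_Theta_add[of "p - q" q] Im_Theta_diff[of p "p - q"] by auto

section \<open>Polynomials in xi act as differential operators modulo the image\<close>

lemma Var_power_mult_in_z_cong: "Var (Xi i) ^ k * in_z q \<approx> in_z ((partial i ^^ k) q)"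
proof (induction k)
  case 0
  show ?case by (simp add: cong_Theta_refl)
next
  case (Suc k)
  have Xi: "Var (Xi i) = in_xi (Var i)"
    by (simp add: in_xi_def subst_poly_Var)
  have "Var (Xi i) ^ Suc k * in_z q \<approx> Var (Xi i) * in_z ((partial i ^^ k) q)"
    using cong_Theta_in_xi_mult[OF Suc.IH, of "Var i"] by (simp add: mult.assoc flip: Xi)
  also have "\<dots> \<approx> in_z ((partial i ^^ Suc k) q)"
    using Theta_in_Im_Theta[of i "in_z ((partial i ^^ k) q)"]
    by (simp add: cong_Theta_def Theta_def partial_Z_in_z)
  finally show ?case .
qed

text \<open>The multi-index version, for a finite set of variables, so that the induction follows the fold
  that defines \<open>partials\<close>.\<close>

lemma monomial_mult_in_z_cong:
  assumes "finite S"
  shows "(\<Prod>i\<in>S. Var (Xi i) ^ k i) * in_z q \<approx>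
    in_z (Finite_Set.fold (\<lambda>i. partial i ^^ k i) q S)"
  using assms
proof (induction S)
  case empty
  show ?case by (simp add: cong_Theta_refl)
next
  case (insert j S)
  interpret comp_fun_commute "\<lambda>i. partial i ^^ k i"
    by (rule comp_fun_commute_partial)
  let ?r = "Finite_Set.fold (\<lambda>i. partial i ^^ k i) q S"
  have Xi: "Var (Xi j) ^ k j = in_xi (Var j ^ k j)"
    by (simp add: in_xi_def subst_poly_power subst_poly_Var)
  have "(\<Prod>i\<in>insert j S. Var (Xi i) ^ k i) * in_z q \<approx> Var (Xi j) ^ k j * in_z ?r"
    using cong_Theta_in_xi_mult[OF insert.IH, of "Var j ^ k j"] insert.hyps
    by (simp add: mult.assoc flip: Xi)
  also have "\<dots> \<approx> in_z ((partial j ^^ k j) ?r)"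
    by (rule Var_power_mult_in_z_cong)
  also have "(partial j ^^ k j) ?r = Finite_Set.fold (\<lambda>i. partial i ^^ k i) q (insert j S)"
    using insert.hyps by simp
  finally show ?case .
qed

lemma in_xi_mult_in_z_cong: "in_xi A * in_z q \<approx> in_z (diff_op A q)"
proof -
  let ?c = "Poly_Mapping.lookup A"
  let ?mon = "\<lambda>\<alpha>. \<Prod>i\<in>Poly_Mapping.keys \<alpha>. Var (Xi i) ^ Poly_Mapping.lookup \<alpha> i"
  have "in_xi A * in_z q = (\<Sum>\<alpha>\<in>Poly_Mapping.keys A. in_xi (const (?c \<alpha>)) * (?mon \<alpha> * in_z q))"
    unfolding in_xi_def subst_poly_const
    by (simp add: subst_poly_def sum_distrib_right mult.assoc)
  also have "\<dots> \<approx> (\<Sum>\<alpha>\<in>Poly_Mapping.keys A. in_xi (const (?c \<alpha>)) * in_z (partials \<alpha> q))"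
    unfolding partials_def
    by (intro cong_Theta_sum cong_Theta_in_xi_mult monomial_mult_in_z_cong) simp
  also have "\<dots> = in_z (diff_op A q)"
    by (simp add: in_xi_def in_z_def diff_op_def subst_poly_sum subst_poly_mult subst_poly_const)
  finally show ?thesis .
qed

lemma in_xi_power_mult_in_z_cong: "in_xi A ^ m * in_z q \<approx> in_z ((diff_op A ^^ m) q)"
proof (induction m)
  case 0
  show ?case by (simp add: cong_Theta_refl)
next
  case (Suc m)
  have "in_xi A ^ Suc m * in_z q \<approx> in_xi A * in_z ((diff_op A ^^ m) q)"
    using cong_Theta_in_xi_mult[OF Suc.IH, of A] by (simp add: mult.assoc)
  also have "\<dots> \<approx> in_z ((diff_op A ^^ Suc m) q)"
    by (simp add: in_xi_mult_in_z_cong)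
  finally show ?case .
qed

section \<open>No non-zero polynomial in z lies in the image\<close>

text \<open>The value at the monomial \<open>\<xi>\<^sup>\<alpha> z\<^sup>\<beta>\<close> with exponent \<open>\<gamma>\<close> of the functional that detects \<open>z\<^sup>\<delta>\<close>:
  it is \<open>\<beta>!\<close> if \<open>\<beta> = \<alpha> + \<delta>\<close>, and \<open>0\<close> otherwise.\<close>

definition weight :: "('n::finite \<Rightarrow>\<^sub>0 nat) \<Rightarrow> ('n xi_z \<Rightarrow>\<^sub>0 nat) \<Rightarrow> complex" where
  "weight \<delta> \<gamma> =
    (if \<forall>j. Poly_Mapping.lookup \<gamma> (Z j) = Poly_Mapping.lookup \<gamma> (Xi j) + Poly_Mapping.lookup \<delta> j
     then \<Prod>j\<in>UNIV. fact (Poly_Mapping.lookup \<gamma> (Z j)) else 0)"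

text \<open>For \<open>\<beta>\<^sub>i > 0\<close>, where \<open>\<beta>\<close> is the exponent of \<open>z\<close> in \<open>\<gamma>\<close>, this is
  \<open>\<beta>! = \<beta>\<^sub>i (\<beta> - e\<^sub>i)!\<close>; for \<open>\<beta>\<^sub>i = 0\<close> both weighted terms are \<open>0\<close>, the left one because then
  \<open>\<beta> = \<alpha> + e\<^sub>i + \<delta>\<close> is impossible.\<close>

lemma weight_shift:
  "weight \<delta> (Poly_Mapping.single (Xi i) 1 + \<gamma>) =
     of_nat (Poly_Mapping.lookup \<gamma> (Z i)) * weight \<delta> (\<gamma> - Poly_Mapping.single (Z i) 1)"
proof (cases "Poly_Mapping.lookup \<gamma> (Z i)")
  case 0
  then have "Poly_Mapping.lookup (Poly_Mapping.single (Xi i) 1 + \<gamma>) (Z i) \<noteq>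
      Poly_Mapping.lookup (Poly_Mapping.single (Xi i) 1 + \<gamma>) (Xi i) + Poly_Mapping.lookup \<delta> i"
    by (simp add: lookup_add lookup_single)
  then show ?thesis using 0 unfolding weight_def by auto
next
  case (Suc k)
  let ?x = "Poly_Mapping.single (Xi i) 1 + \<gamma>" and ?y = "\<gamma> - Poly_Mapping.single (Z i) 1"
  have x: "Poly_Mapping.lookup ?x (Z j) = Poly_Mapping.lookup \<gamma> (Z j)"
          "Poly_Mapping.lookup ?x (Xi j) = Poly_Mapping.lookup \<gamma> (Xi j) + (if j = i then 1 else 0)"
    and y: "Poly_Mapping.lookup ?y (Z j) = (if j = i then k else Poly_Mapping.lookup \<gamma> (Z j))"
           "Poly_Mapping.lookup ?y (Xi j) = Poly_Mapping.lookup \<gamma> (Xi j)" for j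
    using Suc by (auto simp: lookup_add lookup_minus lookup_single)
  have prod: "(\<Prod>j\<in>UNIV. fact (Poly_Mapping.lookup ?x (Z j)) :: complex) =
      of_nat (Suc k) * (\<Prod>j\<in>UNIV. fact (Poly_Mapping.lookup ?y (Z j)))"
    unfolding x y using Suc
    by (subst (1 2) prod.remove[of _ i]) (simp_all add: mult_ac)
  have "(\<forall>j. Poly_Mapping.lookup ?x (Z j) = Poly_Mapping.lookup ?x (Xi j) + Poly_Mapping.lookup \<delta> j)
    \<longleftrightarrow> (\<forall>j. Poly_Mapping.lookup ?y (Z j) = Poly_Mapping.lookup ?y (Xi j) + Poly_Mapping.lookup \<delta> j)"
    unfolding x y using Suc by (intro all_cong1) auto
  then show ?thesis
    unfolding weight_def prod using Suc by simp
qed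

text \<open>On monomials this is the identity \<open>weight_shift\<close>: multiplication by \<open>\<xi>\<^sub>i\<close> and \<open>\<partial>/\<partial>z\<^sub>i\<close> have the
  same effect on the functional.\<close>

lemma lin_ext_weight_Theta: "lin_ext (weight \<delta>) (Theta i h) = 0"
proof (induction h rule: cpoly_induct)
  case (single \<gamma> c)
  show ?case
    by (simp add: Theta_def Var_def mult_single partial_single lin_ext_diff lin_ext_single
        weight_shift[simplified])
qed (simp add: Theta_add lin_ext_add)

lemma lin_ext_weight_in_z:
  "lin_ext (weight \<delta>) (in_z p) =
     Poly_Mapping.lookup p \<delta> * (\<Prod>j\<in>UNIV. fact (Poly_Mapping.lookup \<delta> j))"
proof (induction p rule: cpoly_induct)
  case (single \<alpha> c)
  let ?\<gamma> = "\<Sum>i\<in>Poly_Mapping.keys \<alpha>. Poly_Mapping.single (Z i) (Poly_Mapping.lookup \<alpha> i)"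
  have Z: "Poly_Mapping.lookup ?\<gamma> (Z j) = Poly_Mapping.lookup \<alpha> j"
    and Xi: "Poly_Mapping.lookup ?\<gamma> (Xi j) = 0" for j
    by (simp_all add: lookup_sum lookup_single when_def in_keys_iff)
  have "weight \<delta> ?\<gamma> = (if \<alpha> = \<delta> then \<Prod>j\<in>UNIV. fact (Poly_Mapping.lookup \<delta> j) else 0)"
    unfolding weight_def Z Xi by (auto simp: poly_mapping_eq_iff fun_eq_iff)
  moreover have "in_z (Poly_Mapping.single \<alpha> c) = Poly_Mapping.single ?\<gamma> c"
    by (simp add: in_z_def subst_poly_single monomial_eq_single const_def mult_single)
  ultimately show ?case
    by (simp add: lin_ext_single lookup_single)
qed (simp add: in_z_def subst_poly_add lin_ext_add lookup_add distrib_right)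

lemma in_z_in_Im_Theta_iff: "in_z p \<in> Im_Theta \<longleftrightarrow> p = 0"
proof
  assume "in_z p \<in> Im_Theta"
  then obtain h where h: "in_z p = (\<Sum>i\<in>UNIV. Theta i (h i))"
    unfolding Im_Theta_iff by blast
  have "lin_ext (weight \<delta>) (in_z p) = 0" for \<delta>
    unfolding h by (simp add: lin_ext_sum lin_ext_weight_Theta)
  then show "p = 0"
    by (intro poly_mapping_eqI) (simp add: lin_ext_weight_in_z)
qed (simp add: in_z_def subst_poly_0 Im_Theta_0)

section \<open>Equivalence of the two conjectures\<close>

lemma in_xi_power_mult_in_z_in_Im_Theta_iff:
  "in_xi A ^ m * in_z q \<in> Im_Theta \<longleftrightarrow> (diff_op A ^^ m) q = 0"
  using cong_Theta_Im_Theta_iff[OF in_xi_power_mult_in_z_cong] in_z_in_Im_Theta_iff by blast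

theorem theorem3p5:
  fixes \<Lambda> P g :: "'n::finite cpoly"
    and f :: "'n xi_z cpoly"
  assumes "f = in_xi \<Lambda> * in_z P"
  shows "((\<forall>m\<ge>1. (diff_op \<Lambda> ^^ m) (P ^ m) = 0) \<longrightarrow>
            (\<forall>\<^sub>F m in sequentially. (diff_op \<Lambda> ^^ m) (P ^ m * g) = 0))
         \<longleftrightarrow>
         ((\<forall>m\<ge>1. f ^ m \<in> Im_Theta) \<longrightarrow>
            (\<forall>\<^sub>F m in sequentially. f ^ m * in_z g \<in> Im_Theta))"
proof -
  have f: "f ^ m = in_xi \<Lambda> ^ m * in_z (P ^ m)" for m
    by (simp add: assms power_mult_distrib in_z_def subst_poly_power)
  have fg: "f ^ m * in_z g = in_xi \<Lambda> ^ m * in_z (P ^ m * g)" for m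
    by (simp add: f in_z_def subst_poly_mult mult.assoc)
  show ?thesis
    unfolding fg unfolding f in_xi_power_mult_in_z_in_Im_Theta_iff ..
qed

end
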